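(* Let $m_1, l_2, m_2$ be positive integers with $m_1 < l_2 \le m_2$, and let $k$ be a positive integer. Then (a) $\displaystyle f([1,m_1]\cup[l_2,m_2]) = \sum_{d=1}^{m_2} \mu(d)\left(2^{\lfloor m_1/d\rfloor + \lfloor m_2/d\rfloor - \lfloor (l_2-1)/d\rfloor} - 1\right)$; (b) $\displaystyle f_k([1,m_1]\cup[l_2,m_2]) = \sum_{d=1}^{m_2} \mu(d) \binom{\lfloor m_1/d\rfloor + \lfloor m_2/d\rfloor - \lfloor (l_2-1)/d\rfloor}{k}$.
   Context: For positive integers $l \le m$, $[l,m] = \{l, l+1, \ldots, m\}$. For a nonempty finite set $A$ of positive integers, $f(A)$ is the number of nonempty subsets $X \subseteq A$ with $\gcd(X) = 1$, and $f_k(A)$ is the number of subsets $X \subseteq A$ with $\#X = k$ and $\gcd(X)=1$. $\mu$ is the Möbius function and $\lfloor x\rfloor$ the floor of $x$. *)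

theory Defs
  imports Complex_Main "HOL-Computational_Algebra.Squarefree"
begin

definition moebius_mu :: "nat \<Rightarrow> int" where
  "moebius_mu n = (if squarefree n then (- 1) ^ card (prime_factors n) else 0)"

definition num_coprime_subsets :: "nat set \<Rightarrow> nat" where
  "num_coprime_subsets A = card {X. X \<subseteq> A \<and> X \<noteq> {} \<and> Gcd X = 1}"

definition num_coprime_subsets_of_card :: "nat \<Rightarrow> nat set \<Rightarrow> nat" where
  "num_coprime_subsets_of_card k A = card {X. X \<subseteq> A \<and> card X = k \<and> Gcd X = 1}"

end

theory Submission
  imports Defs
begin

text \<open>
  Moebius inversion on the gcd: the indicator of \<open>Gcd X = 1\<close> is the sum of
  \<open>moebius_mu d\<close> over the common divisors \<open>d\<close> of \<open>X\<close>. Interchanging sums reduces both formulas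
  to counting the (nonempty, or \<open>k\<close>-element) subsets of the multiples of \<open>d\<close> in the given set.
\<close>

text \<open>A prime coprime to \<open>d\<close> leaves squarefreeness unchanged and adds exactly one
  prime factor, so the sign flips; when \<open>d\<close> is not squarefree both sides are 0.\<close>

lemma moebius_mu_prime_mult:
  assumes "prime p" "\<not> p dvd d"
  shows "moebius_mu (p * d) = - moebius_mu d"
proof -
  have "d \<noteq> 0" "p \<noteq> 0" using assms by (auto intro: Nat.gr0I)
  have cop: "coprime p d" using assms prime_imp_coprime by blast
  have sf: "squarefree (p * d) \<longleftrightarrow> squarefree d"
    using cop assms(1) by (meson dvd_triv_right squarefree_mono squarefree_mult_coprime squarefree_prime)
  have "prime_factors (p * d) = insert p (prime_factors d)"
    using \<open>d \<noteq> 0\<close> \<open>p \<noteq> 0\<close> assms(1)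
    by (simp add: prime_factorization_mult prime_factorization_prime)
  moreover have "p \<notin> prime_factors d" using assms(2) by auto
  ultimately show ?thesis by (simp add: moebius_mu_def sf)
qed

text \<open>For a fixed prime \<open>p\<close> dividing \<open>n\<close>, the squarefree divisors
  fall into pairs \<open>e\<close>, \<open>p * e\<close> with \<open>p\<close> not dividing
  \<open>e\<close>, and the two terms of each pair cancel.\<close>

lemma sum_moebius_mu_divisors:
  assumes "n > 0"
  shows "(\<Sum>d | d dvd n. moebius_mu d) = (if n = 1 then 1 else 0)"
proof (cases "n = 1")
  case True
  then show ?thesis by (simp add: moebius_mu_def)
next
  case False
  obtain p where p: "prime p" "p dvd n" using prime_factor_nat[OF False] by blast
  define S where "S = {d. d dvd n \<and> squarefree d}"
  define S0 where "S0 = {d \<in> S. \<not> p dvd d}"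
  have fin: "finite {d. d dvd n}" using assms by simp
  then have finS: "finite S" by (rule rev_finite_subset) (auto simp: S_def)
  then have finS0: "finite S0" by (simp add: S0_def)
  have "p \<noteq> 0" using p(1) by (auto intro: Nat.gr0I)
  \<comment> \<open>Squarefreeness makes this work in one direction: a \<open>d\<close> in
    \<open>S\<close> divisible by \<open>p\<close> is not divisible by the square of
    \<open>p\<close>, so its cofactor lies in \<open>S0\<close>. Conversely, \<open>p\<close> and
    \<open>e\<close> are coprime divisors of \<open>n\<close>, so their product divides
    \<open>n\<close>.\<close>
  have split: "S = S0 \<union> (*) p ` S0"
  proof (intro equalityI subsetI)
    fix d assume d: "d \<in> S"
    show "d \<in> S0 \<union> (*) p ` S0"
    proof (cases "p dvd d")
      case True
      then obtain e where e: "d = p * e" by blast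
      have "\<not> p dvd e"
      proof
        assume "p dvd e"
        then have "p\<^sup>2 dvd d" by (simp add: e power2_eq_square)
        then have "is_unit p" using d by (auto simp: S_def squarefree_def)
        then show False using p(1) by (simp add: prime_nat_iff)
      qed
      moreover have "e dvd d" by (simp add: e)
      ultimately have "e \<in> S0"
        using d by (auto simp: S0_def S_def intro: squarefree_mono dvd_trans)
      then show ?thesis unfolding e by blast
    qed (use d in \<open>simp add: S0_def\<close>)
  next
    fix d assume "d \<in> S0 \<union> (*) p ` S0"
    then show "d \<in> S"
    proof
      assume "d \<in> (*) p ` S0"
      then obtain e where e: "d = p * e" "e \<in> S" "\<not> p dvd e" by (auto simp: S0_def)
      have "coprime p e" using p(1) e(3) prime_imp_coprime by blast
      then show ?thesis
        using e p by (auto simp: S_def intro: divides_mult squarefree_mult_coprime squarefree_prime)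
    qed (simp add: S0_def)
  qed
  have "(\<Sum>d | d dvd n. moebius_mu d) = (\<Sum>d\<in>S. moebius_mu d)"
    by (rule sum.mono_neutral_right[OF fin]) (auto simp: S_def moebius_mu_def)
  also have "\<dots> = (\<Sum>d\<in>S0. moebius_mu d) + (\<Sum>d\<in>(*) p ` S0. moebius_mu d)"
    unfolding split using finS0 by (intro sum.union_disjoint) (auto simp: S0_def)
  also have "(\<Sum>d\<in>(*) p ` S0. moebius_mu d) = (\<Sum>d\<in>S0. moebius_mu (p * d))"
    using \<open>p \<noteq> 0\<close> by (subst sum.reindex) (auto simp: inj_on_def)
  also have "\<dots> = (\<Sum>d\<in>S0. - moebius_mu d)"
    using p(1) by (intro sum.cong) (auto simp: S0_def moebius_mu_prime_mult)
  finally show ?thesis using False by (simp add: sum_negf)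
qed

text \<open>Stated for an arbitrary family \<open>F\<close> so that it serves both counts. Nonempty
  members inside \<open>{1..N}\<close> have a positive gcd of at most \<open>N\<close>, whereas
  \<open>Gcd {} = 0\<close> would have every number as a divisor.\<close>

lemma card_Gcd_eq_1_moebius:
  fixes F :: "nat set set"
  assumes fin: "finite F"
    and F: "\<And>X. X \<in> F \<Longrightarrow> X \<noteq> {} \<and> X \<subseteq> {1..N}"
  shows "int (card {X \<in> F. Gcd X = 1}) =
    (\<Sum>d=1..N. moebius_mu d * int (card {X \<in> F. \<forall>x\<in>X. d dvd x}))"
proof -
  have "int (card {X \<in> F. Gcd X = 1}) = (\<Sum>X\<in>F. if Gcd X = 1 then 1 else 0)"
    using fin by (simp add: sum.If_cases Int_def)
  also have "\<dots> = (\<Sum>X\<in>F. \<Sum>d=1..N. if \<forall>x\<in>X. d dvd x then moebius_mu d else 0)"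
  proof (rule sum.cong[OF refl])
    fix X assume "X \<in> F"
    then obtain x where x: "x \<in> X" "0 < x" "x \<le> N" using F by fastforce
    have "Gcd X dvd x" using x by (simp add: Gcd_dvd)
    then have pos: "Gcd X > 0" and le: "Gcd X \<le> N"
      using x dvd_imp_le[of "Gcd X" x] by (auto intro!: Nat.gr0I)
    \<comment> \<open>The range of \<open>d\<close> becomes independent of \<open>X\<close>, which
      is what allows the two sums to be interchanged below.\<close>
    have "{d. d dvd Gcd X} = {d \<in> {1..N}. \<forall>x\<in>X. d dvd x}"
    proof -
      have "d \<in> {1..N}" if "d dvd Gcd X" for d
        using that pos le dvd_imp_le[OF that pos] dvd_pos_nat[OF pos that] by simp
      then show ?thesis by (auto simp: dvd_Gcd_iff)
    qed
    then have "(\<Sum>d | d dvd Gcd X. moebius_mu d) =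
        (\<Sum>d=1..N. if \<forall>x\<in>X. d dvd x then moebius_mu d else 0)"
      by (simp only: sum.inter_filter finite_atLeastAtMost)
    then show "(if Gcd X = 1 then 1 else 0) =
        (\<Sum>d=1..N. if \<forall>x\<in>X. d dvd x then moebius_mu d else 0)"
      using sum_moebius_mu_divisors[OF pos] by simp
  qed
  also have "\<dots> = (\<Sum>d=1..N. \<Sum>X\<in>F. if \<forall>x\<in>X. d dvd x then moebius_mu d else 0)"
    by (rule sum.swap)
  also have "\<dots> = (\<Sum>d=1..N. moebius_mu d * int (card {X \<in> F. \<forall>x\<in>X. d dvd x}))"
    using fin by (intro sum.cong) (simp_all add: sum.If_cases Int_def)
  finally show ?thesis .
qed

lemma card_multiples_upto:
  fixes d m :: nat
  assumes "d > 0"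
  shows "card {x \<in> {1..m}. d dvd x} = m div d"
proof -
  have "{x \<in> {1..m}. d dvd x} = (*) d ` {1..m div d}"
    using assms by (auto simp: less_eq_div_iff_mult_less_eq mult.commute Suc_le_eq image_iff dvd_def)
  moreover have "inj_on ((*) d) {1..m div d}" using assms by (auto simp: inj_on_def)
  ultimately show ?thesis by (simp add: card_image)
qed

text \<open>The multiples in \<open>{l2..m2}\<close> are those up to \<open>m2\<close> minus those
  up to \<open>l2 - 1\<close>; they are disjoint from the multiples up to \<open>m1\<close> because
  \<open>m1 < l2\<close>.\<close>

lemma card_multiples_two_intervals:
  fixes d m1 l2 m2 :: nat
  assumes "d > 0" "m1 < l2" "l2 \<le> m2"
  shows "card {x \<in> {1..m1} \<union> {l2..m2}. d dvd x} = m1 div d + m2 div d - (l2 - 1) div d"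
proof -
  let ?M = "\<lambda>m. {x \<in> {1..m}. d dvd x}"
  have eq: "{x \<in> {1..m1} \<union> {l2..m2}. d dvd x} = ?M m1 \<union> (?M m2 - ?M (l2 - 1))"
    using assms by auto
  have "card (?M m2 - ?M (l2 - 1)) = card (?M m2) - card (?M (l2 - 1))"
    using assms by (intro card_Diff_subset) auto
  moreover have "card (?M m1 \<union> (?M m2 - ?M (l2 - 1))) = card (?M m1) + card (?M m2 - ?M (l2 - 1))"
    using assms by (intro card_Un_disjoint) auto
  \<comment> \<open>Subtraction on \<open>nat\<close> is truncated, so this inequality is what
    permits rewriting \<open>a + (b - c)\<close> as \<open>a + b - c\<close>.\<close>
  moreover have "(l2 - 1) div d \<le> m2 div d" using assms by (intro div_le_mono) simp
  ultimately show ?thesis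
    unfolding eq using assms(1) by (simp only: card_multiples_upto Nat.add_diff_assoc)
qed

lemma num_coprime_subsets_moebius:
  assumes A: "A \<subseteq> {1..N}"
  shows "int (num_coprime_subsets A) =
    (\<Sum>d=1..N. moebius_mu d * (2 ^ card {x \<in> A. d dvd x} - 1))"
proof -
  have finA: "finite A" using A finite_subset by blast
  let ?F = "Pow A - {{}}"
  have "num_coprime_subsets A = card {X \<in> ?F. Gcd X = 1}"
    unfolding num_coprime_subsets_def by (rule arg_cong[where f = card]) auto
  also have "int \<dots> = (\<Sum>d=1..N. moebius_mu d * int (card {X \<in> ?F. \<forall>x\<in>X. d dvd x}))"
    using A finA by (intro card_Gcd_eq_1_moebius) auto
  also have "\<dots> = (\<Sum>d=1..N. moebius_mu d * (2 ^ card {x \<in> A. d dvd x} - 1))"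
  proof (rule sum.cong[OF refl])
    fix d
    have "{X \<in> ?F. \<forall>x\<in>X. d dvd x} = Pow {x \<in> A. d dvd x} - {{}}" by auto
    \<comment> \<open>The removed empty set accounts for the \<open>- 1\<close>. This is still
      subtraction on \<open>nat\<close>; it carries over to \<open>int\<close> because a power of 2
      is at least 1.\<close>
    then have "card {X \<in> ?F. \<forall>x\<in>X. d dvd x} = 2 ^ card {x \<in> A. d dvd x} - 1"
      using finA by (simp add: card_Diff_subset card_Pow)
    then show "moebius_mu d * int (card {X \<in> ?F. \<forall>x\<in>X. d dvd x}) =
        moebius_mu d * (2 ^ card {x \<in> A. d dvd x} - 1)"
      by (simp add: of_nat_diff)
  qed
  finally show ?thesis .
qed

lemma num_coprime_subsets_of_card_moebius:
  assumes A: "A \<subseteq> {1..N}" and "k > 0"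
  shows "int (num_coprime_subsets_of_card k A) =
    (\<Sum>d=1..N. moebius_mu d * int (card {x \<in> A. d dvd x} choose k))"
proof -
  have finA: "finite A" using A finite_subset by blast
  let ?F = "{X. X \<subseteq> A \<and> card X = k}"
  have "num_coprime_subsets_of_card k A = card {X \<in> ?F. Gcd X = 1}"
    unfolding num_coprime_subsets_of_card_def by (rule arg_cong[where f = card]) auto
  \<comment> \<open>Here \<open>k > 0\<close> keeps the empty set out of the family, as the
    inversion lemma requires.\<close>
  also have "int \<dots> = (\<Sum>d=1..N. moebius_mu d * int (card {X \<in> ?F. \<forall>x\<in>X. d dvd x}))"
    using A finA \<open>k > 0\<close> by (intro card_Gcd_eq_1_moebius) auto
  also have "\<dots> = (\<Sum>d=1..N. moebius_mu d * int (card {x \<in> A. d dvd x} choose k))"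
  proof (rule sum.cong[OF refl])
    fix d
    have "{X \<in> ?F. \<forall>x\<in>X. d dvd x} = {X. X \<subseteq> {x \<in> A. d dvd x} \<and> card X = k}" by auto
    then show "moebius_mu d * int (card {X \<in> ?F. \<forall>x\<in>X. d dvd x}) =
        moebius_mu d * int (card {x \<in> A. d dvd x} choose k)"
      using finA by (simp add: n_subsets)
  qed
  finally show ?thesis .
qed

theorem theorem2:
  fixes m1 l2 m2 k :: nat
  assumes "0 < m1" and "0 < l2" and "0 < m2" and "m1 < l2" and "l2 \<le> m2" and "0 < k"
  shows "int (num_coprime_subsets ({1..m1} \<union> {l2..m2})) =
           (\<Sum>d=1..m2. moebius_mu d * (2 ^ (m1 div d + m2 div d - (l2 - 1) div d) - 1)) \<and>
         int (num_coprime_subsets_of_card k ({1..m1} \<union> {l2..m2})) =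
           (\<Sum>d=1..m2. moebius_mu d * int ((m1 div d + m2 div d - (l2 - 1) div d) choose k))"
proof -
  have sub: "{1..m1} \<union> {l2..m2} \<subseteq> {1..m2}" using assms by auto
  have card_mult: "card {x \<in> {1..m1} \<union> {l2..m2}. d dvd x} = m1 div d + m2 div d - (l2 - 1) div d"
    if "d \<in> {1..m2}" for d
    using that assms by (intro card_multiples_two_intervals) auto
  show ?thesis
    unfolding num_coprime_subsets_moebius[OF sub]
      num_coprime_subsets_of_card_moebius[OF sub \<open>0 < k\<close>]
    \<comment> \<open>Both identities now differ from the goal only in the count of multiples;
      \<open>sum.cong\<close> supplies \<open>d \<in> {1..m2}\<close>, hence the
      \<open>d > 0\<close> behind \<open>card_mult\<close>.\<close>
    by (intro conjI sum.cong refl) (simp_all only: card_mult)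
qed

end
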